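(* Let $M$ be a monoid, let $K$ be a field, and let $d\ge 1$ be an integer. Then the map $\Psi\colon \mathrm{Mat}_d(K[M])\to \mathrm{LCA}(M,K^d)$ given by $\Psi(A):=\tau_A$ for all $A\in \mathrm{Mat}_d(K[M])$, where $\tau_A\colon (K^d)^M\to (K^d)^M$ is defined by $\tau_A(c):=c*A$ for all $c\in (K^d)^M$, is an anti-isomorphism of $K$-algebras.
   Context: For a set $V$, $V^M$ is the set of all maps $c\colon M\to V$. For $m\in M$, $R_m\colon M\to M$ is $R_m(x)=xm$. A map $\tau\colon V^M\to V^M$ is a cellular automaton over $(M,V)$ if there exist a finite subset $S\subset M$ and a map $\mu\colon V^S\to V$ such that $\tau(c)(m)=\mu\big((c\circ R_m)|_S\big)$ for all $c\in V^M$, $m\in M$. If $V$ is a $K$-vector space, $V^M$ has the product (pointwise) $K$-vector space structure, and a linear cellular automaton over $(M,V)$ is a cellular automaton $\tau\colon V^M\to V^M$ that is $K$-linear. $\mathrm{LCA}(M,V)$ is the set of all linear cellular automata $V^M\to V^M$; it is a $K$-subalgebra of $\mathrm{End}_K(V^M)$ (with composition as multiplication). The monoid algebra $K[M]$ is the $K$-algebra with $K$-basis $M$ and multiplication extending that of $M$ $K$-linearly. For $c\in K^M$ and $\alpha=\sum_{m\in M}\alpha_m m\in K[M]$ (with $\alpha_m\in K$, almost all zero), define $c*\alpha\in K^M$ by $(c*\alpha)(m):=\sum_{s\in \mathrm{supp}(\alpha)}c(sm)\alpha_s$, where $\mathrm{supp}(\alpha)=\{m\in M:\alpha_m\ne 0\}$.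 Identify $(K^d)^M=(K^M)^d$ naturally. For $c=(c_1,\dots,c_d)\in (K^M)^d$ and $A=(\alpha_{ij})_{1\le i,j\le d}\in \mathrm{Mat}_d(K[M])$ define $c*A=((c*A)_1,\dots,(c*A)_d)$ with $(c*A)_j:=\sum_{i=1}^d c_i*\alpha_{ij}\in K^M$. An anti-isomorphism of $K$-algebras is a bijective $K$-linear map $f$ preserving the identity element and satisfying $f(xy)=f(y)f(x)$ for all $x,y$. *)

theory Defs
  imports "HOL-Analysis.Analysis" "HOL-Library.Function_Algebras" "HOL-Library.Poly_Mapping"
begin

text \<open>
  The monoid \<open>M\<close> is a type of class \<^class>\<open>monoid_add\<close>, i.e. an arbitrary, not necessarily
  commutative, monoid written additively: \<open>x + y\<close> stands for the product \<open>xy\<close> and \<open>0\<close> for the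
  identity element.  This is the convention of \<open>HOL-Library.Poly_Mapping\<close>, where the type
  \<open>'m \<Rightarrow>\<^sub>0 'k\<close> of finitely supported functions, with its convolution product, is the monoid algebra
  \<open>K[M]\<close>.  The space \<open>K^d\<close> is \<open>'k ^ 'd\<close>, where \<open>d = CARD('d) \<ge> 1\<close> is arbitrary, and
  \<open>Mat\<^sub>d(K[M])\<close> is \<open>('m \<Rightarrow>\<^sub>0 'k) ^ 'd ^ 'd\<close> with row-column product \<open>**\<close> and identity \<open>mat 1\<close>.
  Addition of functions is pointwise (\<open>HOL-Library.Function_Algebras\<close>).
\<close>

subsection \<open>Algebras over a field and their anti-isomorphisms\<close>

text \<open>
  Associative unital algebras over a field whose underlying vector space is a subspace \<open>S\<close> of an
  ambient vector space.  The algebra axioms are only required on \<open>S\<close>: for maps from a vector space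
  to itself, composition is bilinear on the linear ones but not on all of them.
\<close>

locale algebra_over_field = vector_space scale
  for S :: "'a::ab_group_add set"
    and scale :: "'k::field \<Rightarrow> 'a \<Rightarrow> 'a"
    and mult :: "'a \<Rightarrow> 'a \<Rightarrow> 'a"
    and one :: 'a +
  assumes subspace_carrier: "subspace S"
    and one_closed: "one \<in> S"
    and mult_closed: "x \<in> S \<Longrightarrow> y \<in> S \<Longrightarrow> mult x y \<in> S"
    and mult_assoc: "x \<in> S \<Longrightarrow> y \<in> S \<Longrightarrow> z \<in> S \<Longrightarrow> mult (mult x y) z = mult x (mult y z)"
    and mult_one_left: "x \<in> S \<Longrightarrow> mult one x = x"
    and mult_one_right: "x \<in> S \<Longrightarrow> mult x one = x"
    and mult_add_left: "x \<in> S \<Longrightarrow> y \<in> S \<Longrightarrow> z \<in> S \<Longrightarrow> mult (x + y) z = mult x z + mult y z"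
    and mult_add_right: "x \<in> S \<Longrightarrow> y \<in> S \<Longrightarrow> z \<in> S \<Longrightarrow> mult x (y + z) = mult x y + mult x z"
    and mult_scale_left: "x \<in> S \<Longrightarrow> y \<in> S \<Longrightarrow> mult (scale a x) y = scale a (mult x y)"
    and mult_scale_right: "x \<in> S \<Longrightarrow> y \<in> S \<Longrightarrow> mult x (scale a y) = scale a (mult x y)"

locale algebra_anti_isomorphism =
  A: algebra_over_field S scaleA multA oneA + B: algebra_over_field T scaleB multB oneB
  for S :: "'a::ab_group_add set"
    and scaleA :: "'k::field \<Rightarrow> 'a \<Rightarrow> 'a"
    and multA oneA
    and T :: "'b::ab_group_add set"
    and scaleB :: "'k \<Rightarrow> 'b \<Rightarrow> 'b"
    and multB oneB
    and f :: "'a \<Rightarrow> 'b" +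
  assumes bij: "bij_betw f S T"
    and map_add: "x \<in> S \<Longrightarrow> y \<in> S \<Longrightarrow> f (x + y) = f x + f y"
    and map_scale: "x \<in> S \<Longrightarrow> f (scaleA a x) = scaleB a (f x)"
    and map_one: "f oneA = oneB"
    and map_mult: "x \<in> S \<Longrightarrow> y \<in> S \<Longrightarrow> f (multA x y) = multB (f y) (f x)"

definition fun_scale :: "('k \<Rightarrow> 'v \<Rightarrow> 'v) \<Rightarrow> 'k \<Rightarrow> ('x \<Rightarrow> 'v) \<Rightarrow> 'x \<Rightarrow> 'v"
  where "fun_scale sc a f = (\<lambda>x. sc a (f x))"

subsection \<open>Cellular automata\<close>

definition right_translation :: "'m::monoid_add \<Rightarrow> 'm \<Rightarrow> 'm"
  where "right_translation m x = x + m"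

text \<open>
  An element of \<open>V\<^sup>S\<close> is represented by a function that is \<^const>\<open>undefined\<close> outside \<open>S\<close>
  (\<^const>\<open>restrict\<close>); the values of \<open>\<mu>\<close> at functions not of this form are irrelevant.
\<close>

definition cellular_automaton :: "(('m::monoid_add \<Rightarrow> 'v) \<Rightarrow> 'm \<Rightarrow> 'v) \<Rightarrow> bool"
  where "cellular_automaton \<tau> \<longleftrightarrow>
    (\<exists>(S :: 'm set) (\<mu> :: ('m \<Rightarrow> 'v) \<Rightarrow> 'v). finite S \<and>
      (\<forall>c m. \<tau> c m = \<mu> (restrict (c \<circ> right_translation m) S)))"

definition LCA :: "('k::field \<Rightarrow> 'v::ab_group_add \<Rightarrow> 'v) \<Rightarrow>
    (('m::monoid_add \<Rightarrow> 'v) \<Rightarrow> 'm \<Rightarrow> 'v) set"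
  where "LCA sc =
    {\<tau>. cellular_automaton \<tau> \<and> Vector_Spaces.linear (fun_scale sc) (fun_scale sc) \<tau>}"

subsection \<open>The action of matrices over the monoid algebra\<close>

definition monoid_algebra_scale :: "'k::field \<Rightarrow> ('m \<Rightarrow>\<^sub>0 'k) \<Rightarrow> ('m \<Rightarrow>\<^sub>0 'k)"
  where "monoid_algebra_scale a \<alpha> = Poly_Mapping.map ((*) a) \<alpha>"

definition matrix_scale ::
    "'k::field \<Rightarrow> ('m \<Rightarrow>\<^sub>0 'k) ^ 'd ^ 'd \<Rightarrow> ('m \<Rightarrow>\<^sub>0 'k) ^ 'd ^ 'd"
  where "matrix_scale a A = (\<chi> i j. monoid_algebra_scale a (A $ i $ j))"

definition conv :: "('m::monoid_add \<Rightarrow> 'k::field) \<Rightarrow> ('m \<Rightarrow>\<^sub>0 'k) \<Rightarrow> 'm \<Rightarrow> 'k"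
  where "conv c \<alpha> m = (\<Sum>s\<in>Poly_Mapping.keys \<alpha>. c (s + m) * Poly_Mapping.lookup \<alpha> s)"

text \<open>
  Under the identification \<open>(K^d)\<^sup>M = (K\<^sup>M)^d\<close>, the \<open>i\<close>-th component of \<open>c\<close> is \<open>\<lambda>x. c x $ i\<close>.
\<close>

definition tau :: "('m::monoid_add \<Rightarrow>\<^sub>0 'k::field) ^ 'd ^ 'd \<Rightarrow>
    ('m \<Rightarrow> 'k ^ 'd) \<Rightarrow> 'm \<Rightarrow> 'k ^ 'd"
  where "tau A c = (\<lambda>m. \<chi> j. (\<Sum>i\<in>UNIV. conv (\<lambda>x. c x $ i) (A $ i $ j)) m)"

end

theory Submission
  imports Defs
begin

text \<open>
  Put \<open>\<delta>\<^sub>s\<^sub>,\<^sub>i\<close> for the configuration whose only non-zero value is the \<open>i\<close>-th unit vector, at \<open>s\<close>.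
  Evaluating \<open>\<tau>\<^sub>A\<close> on \<open>\<delta>\<^sub>s\<^sub>,\<^sub>i\<close> at the identity of the monoid returns the coefficients at \<open>s\<close> of the
  \<open>i\<close>-th row of \<open>A\<close> (\<open>tau_impulse\<close>), so \<open>A\<close> can be read off from \<open>\<tau>\<^sub>A\<close>.  Conversely, a cellular
  automaton with memory set \<open>S\<close> commutes with right translations and sees only the values of a
  configuration on \<open>S\<close>; up to what happens outside \<open>S\<close>, a configuration is a \<^emph>\<open>finite\<close> linear
  combination of the \<open>\<delta>\<^sub>s\<^sub>,\<^sub>i\<close> with \<open>s \<in> S\<close>.  A linear cellular automaton is therefore determined by
  its values on these impulses (\<open>linear_cellular_automaton_expansion\<close>), and the matrix with these
  values as coefficients represents it.  Hence \<open>\<tau>\<close> is a bijection onto the linear cellular automata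
  (\<open>LCA_eq_range_tau\<close>).

  The order of multiplication is reversed because the matrices act from the right:
  \<open>(c * \<alpha>) * \<beta> = c * (\<alpha>\<beta>)\<close> (\<open>conv_conv\<close>) gives \<open>\<tau>\<^sub>B \<circ> \<tau>\<^sub>A = \<tau>\<^sub>A\<^sub>B\<close>.

  Since the linear cellular automata are exactly the image of \<open>\<tau>\<close>, the compatibility of \<open>\<tau>\<close> with the
  operations also shows that they are closed under sums, scalar multiples and composition; no
  memory sets have to be combined by hand.
\<close>

section \<open>The monoid algebra\<close>

lemma sum_fun_apply: "(\<Sum>a\<in>A. f a) x = (\<Sum>a\<in>A. f a x)"
  by (induction A rule: infinite_finite_induct) auto

lemma poly_mapping_additive_induct [case_names zero single add]:
  assumes "P 0" and "\<And>s a. P (Poly_Mapping.single s a)"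
    and "\<And>f g. P f \<Longrightarrow> P g \<Longrightarrow> P (f + g)"
  shows "P (f :: 'a \<Rightarrow>\<^sub>0 'b::comm_monoid_add)"
proof (induction f rule: update_induct)
  case const
  show ?case by (fact assms(1))
next
  case (update f s a)
  have "Poly_Mapping.update s a f = Poly_Mapping.single s a + f"
    using update.hyps(1)
    by (intro poly_mapping_eqI)
      (auto simp: lookup_update lookup_add lookup_single in_keys_iff when_def)
  then show ?case
    using assms(2,3) update.IH by simp
qed

lemma monoid_algebra_scale_eq_mult:
  "monoid_algebra_scale a \<alpha> = Poly_Mapping.single (0::'m::monoid_add) a * \<alpha>"
  by (simp add: monoid_algebra_scale_def mult_map_scale_conv_mult)

text \<open>
  The monoid may be non-commutative, but multiples of its identity are central because \<open>K\<close> is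
  commutative.
\<close>

lemma scalar_central:
  "\<alpha> * Poly_Mapping.single 0 a = Poly_Mapping.single 0 a * (\<alpha> :: 'm::monoid_add \<Rightarrow>\<^sub>0 'k::field)"
  by (induction \<alpha> rule: poly_mapping_additive_induct)
    (simp_all add: mult_single algebra_simps)

lemma lookup_monoid_algebra_scale:
  "Poly_Mapping.lookup (monoid_algebra_scale a \<alpha>) s = a * Poly_Mapping.lookup \<alpha> s"
  unfolding monoid_algebra_scale_def by transfer (auto simp: when_def)

lemma matrix_scale_nth: "matrix_scale a A $ i $ j = monoid_algebra_scale a (A $ i $ j)"
  by (simp add: matrix_scale_def)

lemma matrix_algebra:
  "algebra_over_field (UNIV :: (('m::monoid_add \<Rightarrow>\<^sub>0 'k::field) ^ 'd ^ 'd) set)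
    matrix_scale (**) (mat 1)"
proof -
  have vs: "vector_space (matrix_scale :: 'k \<Rightarrow> ('m \<Rightarrow>\<^sub>0 'k) ^ 'd ^ 'd \<Rightarrow> _)"
    by unfold_locales
      (simp_all add: vec_eq_iff matrix_scale_nth poly_mapping_eq_iff fun_eq_iff
        lookup_monoid_algebra_scale lookup_add algebra_simps)
  then interpret vector_space "matrix_scale :: 'k \<Rightarrow> ('m \<Rightarrow>\<^sub>0 'k) ^ 'd ^ 'd \<Rightarrow> _" .
  have left: "matrix_scale a A ** B = matrix_scale a (A ** B)"
    for a :: 'k and A B :: "('m \<Rightarrow>\<^sub>0 'k) ^ 'd ^ 'd"
    by (simp add: vec_eq_iff matrix_matrix_mult_def matrix_scale_nth
        monoid_algebra_scale_eq_mult sum_distrib_left mult.assoc)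
  have right: "A ** matrix_scale a B = matrix_scale a (A ** B)"
    for a :: 'k and A B :: "('m \<Rightarrow>\<^sub>0 'k) ^ 'd ^ 'd"
  proof -
    have "\<alpha> * (Poly_Mapping.single 0 a * \<beta>) = Poly_Mapping.single 0 a * (\<alpha> * \<beta>)"
      for \<alpha> \<beta> :: "'m \<Rightarrow>\<^sub>0 'k"
      by (metis mult.assoc scalar_central)
    then show ?thesis
      by (simp add: vec_eq_iff matrix_matrix_mult_def matrix_scale_nth
          monoid_algebra_scale_eq_mult sum_distrib_left)
  qed
  show ?thesis
    by unfold_locales
      (simp_all add: left right matrix_mul_assoc matrix_add_ldistrib,
       simp add: vec_eq_iff matrix_matrix_mult_def sum.distrib distrib_right)
qed

section \<open>The action of the monoid algebra on configurations\<close>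

lemma conv_superset:
  assumes "finite S" "Poly_Mapping.keys \<alpha> \<subseteq> S"
  shows "conv c \<alpha> m = (\<Sum>s\<in>S. c (s + m) * Poly_Mapping.lookup \<alpha> s)"
  unfolding conv_def using assms by (intro sum.mono_neutral_left) (auto simp: in_keys_iff)

lemma conv_add_left: "conv (\<lambda>x. c x + c' x) \<alpha> m = conv c \<alpha> m + conv c' \<alpha> m"
  by (simp add: conv_def sum.distrib distrib_right)

lemma conv_scale_left: "conv (\<lambda>x. a * c x) \<alpha> m = a * conv c \<alpha> m"
  by (simp add: conv_def sum_distrib_left mult.assoc)

lemma conv_zero_left: "conv (\<lambda>x. 0) \<alpha> m = 0"
  by (simp add: conv_def)

lemma conv_sum_left: "conv (\<lambda>x. \<Sum>i\<in>I. c i x) \<alpha> m = (\<Sum>i\<in>I. conv (c i) \<alpha> m)"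
  by (induction I rule: infinite_finite_induct) (simp_all add: conv_add_left conv_zero_left)

lemma conv_zero_right: "conv c 0 m = 0"
  by (simp add: conv_def)

lemma conv_add_right: "conv c (\<alpha> + \<beta>) m = conv c \<alpha> m + conv c \<beta> m"
  unfolding conv_def by (rule setsum_keys_plus_distrib) (simp_all add: distrib_left)

lemma conv_sum_right: "conv c (\<Sum>i\<in>I. \<alpha> i) m = (\<Sum>i\<in>I. conv c (\<alpha> i) m)"
  by (induction I rule: infinite_finite_induct) (simp_all add: conv_add_right conv_zero_right)

lemma conv_single: "conv c (Poly_Mapping.single s a) m = c (s + m) * a"
  by (simp add: conv_def)

text \<open>
  All terms are additive in each argument, which leaves the case of two monomials; that case is
  the associativity \<open>s(tm) = (st)m\<close> of the monoid.
\<close>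

lemma conv_conv: "conv (conv c \<alpha>) \<beta> m = conv c (\<alpha> * \<beta>) m"
proof (induction \<beta> rule: poly_mapping_additive_induct)
  case zero
  show ?case by (simp add: conv_zero_right)
next
  case (single t b)
  show ?case
    by (induction \<alpha> rule: poly_mapping_additive_induct)
      (simp_all add: conv_single conv_zero_right conv_add_right mult_single
        add.assoc mult.assoc distrib_right)
next
  case (add \<beta> \<beta>')
  then show ?case by (simp add: conv_add_right distrib_left)
qed

lemma conv_scale_right: "conv c (monoid_algebra_scale a \<alpha>) m = a * conv c \<alpha> m"
proof -
  have "conv c (Poly_Mapping.single 0 a) = (\<lambda>x. a * c x)"
    by (auto simp: conv_single)
  then show ?thesis
    by (simp add: monoid_algebra_scale_eq_mult conv_scale_left flip: conv_conv)
qed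

section \<open>The action of matrices\<close>

lemma tau_nth: "tau A c m $ j = (\<Sum>i\<in>UNIV. conv (\<lambda>x. c x $ i) (A $ i $ j) m)"
  by (simp add: tau_def sum_fun_apply)

lemma tau_eqI:
  assumes "\<And>c m j. tau A c m $ j = f c m $ j"
  shows "tau A = f"
  using assms by (simp add: fun_eq_iff vec_eq_iff)

lemma tau_add: "tau (A + B) = tau A + tau B"
  by (rule tau_eqI) (simp add: tau_nth conv_add_right sum.distrib)

lemma tau_scale: "tau (matrix_scale a A) = fun_scale (fun_scale (*s)) a (tau A)"
  by (rule tau_eqI)
    (simp add: tau_nth matrix_scale_nth conv_scale_right fun_scale_def sum_distrib_left)

lemma tau_one: "tau (mat 1) = id"
proof (rule tau_eqI)
  fix c :: "'m::monoid_add \<Rightarrow> 'k::field ^ 'd" and m j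
  have "conv (\<lambda>x. c x $ i) (mat 1 $ i $ j) m = (if i = j then c m $ i else 0)" for i
    by (simp add: mat_def conv_zero_right conv_single flip: single_one)
  then show "tau (mat 1) c m $ j = id c m $ j"
    by (simp add: tau_nth)
qed

lemma tau_mult:
  fixes A B :: "('m::monoid_add \<Rightarrow>\<^sub>0 'k::field) ^ 'd ^ 'd"
  shows "tau (A ** B) = tau B \<circ> tau A"
proof (rule tau_eqI)
  fix c :: "'m \<Rightarrow> 'k ^ 'd" and m j
  have "tau (A ** B) c m $ j
      = (\<Sum>i\<in>UNIV. \<Sum>k\<in>UNIV. conv (conv (\<lambda>x. c x $ i) (A $ i $ k)) (B $ k $ j) m)"
    by (simp add: tau_nth matrix_matrix_mult_def conv_sum_right conv_conv)
  also have "\<dots> = (\<Sum>k\<in>UNIV. \<Sum>i\<in>UNIV. conv (conv (\<lambda>x. c x $ i) (A $ i $ k)) (B $ k $ j) m)"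
    by (rule sum.swap)
  also have "\<dots> = (tau B \<circ> tau A) c m $ j"
    by (simp add: tau_nth conv_sum_left)
  finally show "tau (A ** B) c m $ j = (tau B \<circ> tau A) c m $ j" .
qed

section \<open>Linear cellular automata\<close>

lemma vector_space_fun_scale:
  assumes "vector_space sc"
  shows "vector_space (fun_scale sc)"
proof -
  interpret vector_space sc by fact
  show ?thesis
    by unfold_locales (auto simp: fun_scale_def fun_eq_iff algebra_simps)
qed

lemma vector_space_configurations:
  "vector_space (fun_scale (*s) :: 'k::field \<Rightarrow> ('m \<Rightarrow> 'k ^ 'd) \<Rightarrow> _)"
  by (intro vector_space_fun_scale vec.vector_space_axioms)

text \<open>
  The union of the supports of the entries serves as a memory set, and evaluation at the identity
  of the monoid as the local rule.
\<close>

lemma cellular_automaton_tau: "cellular_automaton (tau A)"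
proof -
  define S where "S = (\<Union>i. \<Union>j. Poly_Mapping.keys (A $ i $ j))"
  have fin: "finite S"
    by (simp add: S_def)
  have keys: "Poly_Mapping.keys (A $ i $ j) \<subseteq> S" for i j
    by (auto simp: S_def)
  have "tau A c m = tau A (restrict (c \<circ> right_translation m) S) 0" for c m
    by (simp add: vec_eq_iff tau_nth conv_superset[OF fin keys] right_translation_def)
  with fin show ?thesis
    unfolding cellular_automaton_def
    by (intro exI[of _ S] exI[of _ "\<lambda>c. tau A c 0"]) simp
qed

lemma tau_in_LCA: "tau A \<in> LCA (*s)"
proof -
  have "Vector_Spaces.linear (fun_scale (*s)) (fun_scale (*s)) (tau A)"
    unfolding Vector_Spaces.linear_iff
    by (simp add: vector_space_configurations fun_eq_iff vec_eq_iff tau_nth fun_scale_def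
        conv_add_left conv_scale_left sum.distrib sum_distrib_left)
  then show ?thesis
    by (simp add: LCA_def cellular_automaton_tau)
qed

definition impulse :: "'m \<Rightarrow> 'd \<Rightarrow> 'm \<Rightarrow> 'k::field ^ 'd"
  where "impulse s i x = (if x = s then axis i 1 else 0)"

lemma tau_impulse: "tau A (impulse s i) 0 $ j = Poly_Mapping.lookup (A $ i $ j) s"
proof -
  have "conv (\<lambda>x. impulse s i x $ k) (A $ k $ j) 0
      = (if k = i then Poly_Mapping.lookup (A $ k $ j) s else 0)" for k
  proof -
    have "conv (\<lambda>x. impulse s i x $ k) (A $ k $ j) 0
        = (\<Sum>t\<in>insert s (Poly_Mapping.keys (A $ k $ j)).
            impulse s i t $ k * Poly_Mapping.lookup (A $ k $ j) t)"
      by (subst conv_superset[where S = "insert s (Poly_Mapping.keys (A $ k $ j))"]) auto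
    also have "\<dots> = (\<Sum>t\<in>insert s (Poly_Mapping.keys (A $ k $ j)).
        if t = s then (if k = i then Poly_Mapping.lookup (A $ k $ j) s else 0) else 0)"
      by (rule sum.cong) (auto simp: impulse_def axis_def)
    also have "\<dots> = (if k = i then Poly_Mapping.lookup (A $ k $ j) s else 0)"
      by simp
    finally show ?thesis .
  qed
  then show ?thesis
    by (simp add: tau_nth)
qed

lemma inj_tau: "inj tau"
proof (rule injI)
  fix A B :: "('m::monoid_add \<Rightarrow>\<^sub>0 'k::field) ^ 'd ^ 'd"
  assume "tau A = tau B"
  then have "Poly_Mapping.lookup (A $ i $ j) s = Poly_Mapping.lookup (B $ i $ j) s" for i j s
    by (metis tau_impulse)
  then show "A = B"
    by (simp add: vec_eq_iff poly_mapping_eq_iff fun_eq_iff)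
qed

text \<open>
  On the memory set \<open>S\<close>, the translated configuration \<open>c \<circ> R\<^sub>m\<close> agrees with a finite linear
  combination of impulses, and \<open>\<tau>\<close> cannot tell the two apart at the identity of the monoid.
\<close>

lemma linear_cellular_automaton_expansion:
  fixes \<tau> :: "('m::monoid_add \<Rightarrow> 'k::field ^ 'd) \<Rightarrow> 'm \<Rightarrow> 'k ^ 'd"
  assumes "\<tau> \<in> LCA (*s)"
  obtains S where "finite S"
    "\<And>c m. \<tau> c m = (\<Sum>s\<in>S. \<Sum>i\<in>UNIV. c (s + m) $ i *s \<tau> (impulse s i) 0)"
proof -
  from assms obtain S and \<mu> :: "('m \<Rightarrow> 'k ^ 'd) \<Rightarrow> 'k ^ 'd" where fin: "finite S"
    and \<mu>: "\<And>c m. \<tau> c m = \<mu> (restrict (c \<circ> right_translation m) S)"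
    by (auto simp: LCA_def cellular_automaton_def)
  interpret Vector_Spaces.linear "fun_scale (*s)" "fun_scale (*s)" \<tau>
    using assms by (simp add: LCA_def)
  have "\<tau> c m = (\<Sum>s\<in>S. \<Sum>i\<in>UNIV. c (s + m) $ i *s \<tau> (impulse s i) 0)" for c m
  proof -
    define c' where
      "c' = (\<Sum>s\<in>S. \<Sum>i\<in>UNIV. fun_scale (*s) (c (s + m) $ i) (impulse s i :: 'm \<Rightarrow> 'k ^ 'd))"
    have "c' x = c (x + m)" if "x \<in> S" for x
    proof -
      have "c' x = (\<Sum>s\<in>S. if s = x then \<Sum>i\<in>UNIV. c (s + m) $ i *s axis i 1 else 0)"
        unfolding c'_def sum_fun_apply
        by (rule sum.cong) (auto simp: fun_scale_def impulse_def)
      then show ?thesis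
        using fin that by (simp add: basis_expansion)
    qed
    then have "restrict (c' \<circ> right_translation 0) S = restrict (c \<circ> right_translation m) S"
      by (auto simp: right_translation_def restrict_def)
    then have "\<tau> c m = \<tau> c' 0"
      by (simp add: \<mu>)
    also have "\<dots> = (\<Sum>s\<in>S. \<Sum>i\<in>UNIV. c (s + m) $ i *s \<tau> (impulse s i) 0)"
      unfolding c'_def sum scale sum_fun_apply by (simp add: fun_scale_def)
    finally show ?thesis .
  qed
  with fin that show ?thesis by blast
qed

lemma LCA_eq_range_tau:
  "LCA (*s) = range (tau :: ('m::monoid_add \<Rightarrow>\<^sub>0 'k::field) ^ 'd ^ 'd \<Rightarrow> _)"
proof (intro equalityI subsetI)
  fix \<tau> :: "('m \<Rightarrow> 'k ^ 'd) \<Rightarrow> 'm \<Rightarrow> 'k ^ 'd"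
  assume "\<tau> \<in> LCA (*s)"
  then obtain S where fin: "finite S"
    and \<tau>: "\<And>c m. \<tau> c m = (\<Sum>s\<in>S. \<Sum>i\<in>UNIV. c (s + m) $ i *s \<tau> (impulse s i) 0)"
    by (rule linear_cellular_automaton_expansion) blast
  define A :: "('m \<Rightarrow>\<^sub>0 'k) ^ 'd ^ 'd" where
    "A = (\<chi> i j. \<Sum>s\<in>S. Poly_Mapping.single s (\<tau> (impulse s i) 0 $ j))"
  have "tau A = \<tau>"
  proof (rule tau_eqI)
    fix c m j
    have "tau A c m $ j = (\<Sum>i\<in>UNIV. \<Sum>s\<in>S. c (s + m) $ i * \<tau> (impulse s i) 0 $ j)"
      by (simp add: tau_nth A_def conv_sum_right conv_single)
    also have "\<dots> = (\<Sum>s\<in>S. \<Sum>i\<in>UNIV. c (s + m) $ i * \<tau> (impulse s i) 0 $ j)"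
      by (rule sum.swap)
    also have "\<dots> = \<tau> c m $ j"
      by (subst \<tau>) simp
    finally show "tau A c m $ j = \<tau> c m $ j" .
  qed
  then show "\<tau> \<in> range tau" by blast
qed (auto simp: tau_in_LCA)

text \<open>
  Closure under the operations is read off from \<open>LCA_eq_range_tau\<close>.  Left multiplication respects
  the pointwise operations because the automata are linear; right multiplication always does.
\<close>

lemma LCA_algebra:
  "algebra_over_field (LCA (*s) :: (('m::monoid_add \<Rightarrow> 'k::field ^ 'd) \<Rightarrow> _) set)
    (fun_scale (fun_scale (*s))) (\<circ>) id"
proof -
  let ?L = "LCA (*s) :: (('m \<Rightarrow> 'k ^ 'd) \<Rightarrow> 'm \<Rightarrow> 'k ^ 'd) set"
  let ?sc = "fun_scale (fun_scale (*s)) :: 'k \<Rightarrow> (('m \<Rightarrow> 'k ^ 'd) \<Rightarrow> 'm \<Rightarrow> 'k ^ 'd) \<Rightarrow> _"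
  interpret vector_space ?sc
    by (intro vector_space_fun_scale vector_space_configurations)
  have lin: "x (c + c') = x c + x c'" "x (fun_scale (*s) a c) = fun_scale (*s) a (x c)"
    if "x \<in> ?L" for x c c' a
    using that by (auto simp: LCA_def Vector_Spaces.linear_iff)
  have add: "x + y \<in> ?L" if "x \<in> ?L" "y \<in> ?L" for x y
    using that by (auto simp: LCA_eq_range_tau simp flip: tau_add)
  have scale: "?sc a x \<in> ?L" if "x \<in> ?L" for a x
    using that by (auto simp: LCA_eq_range_tau simp flip: tau_scale)
  have one: "id \<in> ?L"
    by (metis tau_one tau_in_LCA)
  have zero: "0 \<in> ?L"
    using scale[OF one, of 0] by simp
  have mult: "x \<circ> y \<in> ?L" if "x \<in> ?L" "y \<in> ?L" for x y
    using that by (auto simp: LCA_eq_range_tau simp flip: tau_mult)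
  have sub: "subspace ?L"
    by (auto simp: subspace_def zero add scale)
  have sc_apply: "?sc a x c = fun_scale (*s) a (x c)" for a x c
    by (simp add: fun_scale_def)
  have comp_add: "x \<circ> (y + z) = (x \<circ> y) + (x \<circ> z)" if "x \<in> ?L" for x y z
    using that by (intro ext) (simp add: lin)
  have comp_scale: "x \<circ> ?sc a y = ?sc a (x \<circ> y)" if "x \<in> ?L" for a x y
    by (rule ext) (simp only: o_apply sc_apply lin(2)[OF that])
  have add_comp: "(x + y) \<circ> z = (x \<circ> z) + (y \<circ> z)" for x y z :: "('m \<Rightarrow> 'k ^ 'd) \<Rightarrow> _"
    by (intro ext) simp
  have scale_comp: "?sc a x \<circ> y = ?sc a (x \<circ> y)" for a x y
    by (rule ext) (simp only: o_apply sc_apply)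
  show ?thesis
    by unfold_locales
      (simp_all add: sub one mult comp_add comp_scale add_comp scale_comp o_assoc)
qed

theorem theorem3p8:
  fixes \<Psi> :: "('m::monoid_add \<Rightarrow>\<^sub>0 'k::field) ^ 'd ^ 'd \<Rightarrow>
    ('m \<Rightarrow> 'k ^ 'd) \<Rightarrow> 'm \<Rightarrow> 'k ^ 'd"
  assumes "\<And>A. \<Psi> A = tau A"
  shows "algebra_anti_isomorphism
    UNIV matrix_scale (**) (mat 1)
    (LCA (*s)) (fun_scale (fun_scale (*s))) (\<circ>) id
    \<Psi>"
proof -
  have "\<Psi> = tau"
    using assms by blast
  moreover have "bij_betw tau UNIV (LCA (*s) :: (('m \<Rightarrow> 'k ^ 'd) \<Rightarrow> _) set)"
    by (simp add: bij_betw_def inj_tau LCA_eq_range_tau)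
  ultimately show ?thesis
    by (intro algebra_anti_isomorphism.intro algebra_anti_isomorphism_axioms.intro
        matrix_algebra LCA_algebra)
      (simp_all add: tau_add tau_scale tau_one tau_mult)
qed

end
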